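(* Let $A$ be an LM$_\theta$-algebra, let $X(A)$ be its space of prime filters with the maps $f_i^A$ ($i\in I$), and for $G\subseteq X(A)$ put $\Theta_{OS}(G)=\{(a,b)\in A\times A:\ \sigma_A(b)\,\triangle\,\sigma_A(a)\subseteq G\}$, where $\triangle$ is symmetric difference. Then: (i) The set $\mathcal{O}_{CS}(X(A))$ of all open subsets of $X(A)$ whose complements are semimodal, ordered by inclusion, is a lattice isomorphic to the lattice $Con_{LM_\theta}(A)$ of all congruences of $A$, and $G\mapsto\Theta_{OS}(G)$ is an isomorphism. (ii) The set $\mathcal{O}_{C\theta}(X(A))$ of all open subsets of $X(A)$ whose complements are $\theta$-subsets of $X(A)$, ordered by inclusion, is a lattice isomorphic to the lattice $Con_{\theta LM_\theta}(A)$ of all $\theta$-congruences of $A$, and $G\mapsto\Theta_{OS}(G)$ (denoted $\Theta_{O\theta}$ on this set) is an isomorphism.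
   Context: Let $\theta\ge 2$ be the order type of a totally ordered set $J$ with least element $0$, and write $J=\{0\}+I$ (ordinal sum), so $I$ is a chain. An LM$_\theta$-algebra ($\theta$-valued Łukasiewicz–Moisil algebra) is an algebra $\langle A,\vee,\wedge,0,1,\{\phi_i\}_{i\in I},\{\overline{\phi}_i\}_{i\in I}\rangle$ such that $\langle A,\vee,\wedge,0,1\rangle$ is a bounded distributive lattice and for all $i,j\in I$ and $x,y\in A$: (L1) $\phi_i$ is a bounded lattice endomorphism; (L2) $\phi_i x\vee\overline{\phi}_i x=1$ and $\phi_i x\wedge\overline{\phi}_i x=0$; (L3) $\phi_i\phi_j x=\phi_j x$; (L4) $i\le j$ implies $\phi_i x\le\phi_j x$; (L5) if $\phi_i x=\phi_i y$ for all $i\in I$ then $x=y$. A congruence of $A$ is a congruence of this algebra. A $\theta$-congruence is a bounded distributive lattice congruence $\vartheta$ on $A$ such that $(x,y)\in\vartheta$ iff $(\phi_i x,\phi_i y)\in\vartheta$ for all $i\in I$. $X(A)$ is the set of prime filters of $A$ ordered by inclusion, with the topology having as subbasis the sets $\sigma_A(a)=\{P\in X(A): a\in P\}$ and $X(A)\setminus\sigma_A(a)$, $a\in A$; for $i\in I$, $f_i^A:X(A)\to X(A)$ is $f_i^A(P)=\phi_i^{-1}(P)$. A subset $Y\subseteq X(A)$ is semimodal if $\bigcup_{i\in I}f_i^A(Y)\subseteq Y$, and is a $\theta$-subset if $\bigcup_{i\in I}f_i^A(Y)\subseteq Y\subseteq\overline{\bigcup_{i\in I}f_i^A(Y)}$,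 where the bar denotes topological closure. *)

theory Defs
  imports "HOL-Analysis.Abstract_Topology" "HOL-Algebra.Lattice"
begin

text \<open>
  The algebra \<open>A\<close> is the type \<open>'a\<close>, a bounded distributive lattice by its type classes (the
  one-element algebra is allowed), with \<open>0 = bot\<close> and \<open>1 = top\<close>.  The chain \<open>I\<close> is the type \<open>'i\<close>;
  it is nonempty, which is exactly the condition \<open>\<theta> \<ge> 2\<close> on the order type of \<open>J = {0} + I\<close>.
  Unqualified, \<open>top\<close> and \<open>lattice\<close> would refer to the constants of HOL-Algebra.
\<close>

locale lm_algebra =
  fixes phi :: "'i::linorder \<Rightarrow> 'a::{distrib_lattice, bounded_lattice} \<Rightarrow> 'a"
    and phibar :: "'i \<Rightarrow> 'a \<Rightarrow> 'a"
  assumes L1_sup: "phi i (sup x y) = sup (phi i x) (phi i y)"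
    and L1_inf: "phi i (inf x y) = inf (phi i x) (phi i y)"
    and L1_bot: "phi i bot = bot"
    and L1_top: "phi i Orderings.top = Orderings.top"
    and L2_sup: "sup (phi i x) (phibar i x) = Orderings.top"
    and L2_inf: "inf (phi i x) (phibar i x) = bot"
    and L3: "phi i (phi j x) = phi j x"
    and L4: "i \<le> j \<Longrightarrow> phi i x \<le> phi j x"
    and L5: "(\<And>i. phi i x = phi i y) \<Longrightarrow> x = y"


section \<open>Congruences\<close>

definition lattice_congruence :: "('a::{distrib_lattice, bounded_lattice} \<times> 'a) set \<Rightarrow> bool" where
  "lattice_congruence R \<longleftrightarrow> equiv UNIV R \<and>
     (\<forall>x x' y y'. (x, x') \<in> R \<and> (y, y') \<in> R \<longrightarrow>
        (sup x y, sup x' y') \<in> R \<and> (inf x y, inf x' y') \<in> R)"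

definition lm_congruence ::
  "('i \<Rightarrow> 'a::{distrib_lattice, bounded_lattice} \<Rightarrow> 'a) \<Rightarrow> ('i \<Rightarrow> 'a \<Rightarrow> 'a) \<Rightarrow> ('a \<times> 'a) set \<Rightarrow> bool"
  where
  "lm_congruence phi phibar R \<longleftrightarrow> lattice_congruence R \<and>
     (\<forall>i x y. (x, y) \<in> R \<longrightarrow> (phi i x, phi i y) \<in> R \<and> (phibar i x, phibar i y) \<in> R)"

definition theta_congruence ::
  "('i \<Rightarrow> 'a::{distrib_lattice, bounded_lattice} \<Rightarrow> 'a) \<Rightarrow> ('a \<times> 'a) set \<Rightarrow> bool" where
  "theta_congruence phi R \<longleftrightarrow> lattice_congruence R \<and>
     (\<forall>x y. (x, y) \<in> R \<longleftrightarrow> (\<forall>i. (phi i x, phi i y) \<in> R))"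


section \<open>The space of prime filters\<close>

definition prime_filter :: "'a::{distrib_lattice, bounded_lattice} set \<Rightarrow> bool" where
  "prime_filter P \<longleftrightarrow>
     Orderings.top \<in> P \<and> (\<forall>x y. x \<in> P \<and> x \<le> y \<longrightarrow> y \<in> P) \<and> (\<forall>x y. x \<in> P \<and> y \<in> P \<longrightarrow> inf x y \<in> P) \<and>
     P \<noteq> UNIV \<and> (\<forall>x y. sup x y \<in> P \<longrightarrow> x \<in> P \<or> y \<in> P)"

definition prime_spectrum :: "'a::{distrib_lattice, bounded_lattice} set set" where
  "prime_spectrum = {P. prime_filter P}"

definition sigma :: "'a::{distrib_lattice, bounded_lattice} \<Rightarrow> 'a set set" where
  "sigma a = {P \<in> prime_spectrum. a \<in> P}"

definition spectral_top :: "'a::{distrib_lattice, bounded_lattice} set topology" where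
  "spectral_top = topology_generated_by (range sigma \<union> range (\<lambda>a. prime_spectrum - sigma a))"

lemma topspace_spectral_top: "topspace spectral_top = prime_spectrum"
proof -
  have "sigma Orderings.top = prime_spectrum"
    by (auto simp: sigma_def prime_spectrum_def prime_filter_def)
  then have "prime_spectrum \<in> range sigma"
    by (metis rangeI)
  then show ?thesis
    unfolding spectral_top_def topology_generated_by_topspace by (auto simp: sigma_def)
qed

definition spec_map :: "('i \<Rightarrow> 'a \<Rightarrow> 'a) \<Rightarrow> 'i \<Rightarrow> 'a set \<Rightarrow> 'a set" where
  "spec_map phi i P = phi i -` P"

definition semimodal ::
  "('i \<Rightarrow> 'a::{distrib_lattice, bounded_lattice} \<Rightarrow> 'a) \<Rightarrow> 'a set set \<Rightarrow> bool" where
  "semimodal phi Y \<longleftrightarrow> Y \<subseteq> prime_spectrum \<and> (\<Union>i. spec_map phi i ` Y) \<subseteq> Y"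

definition theta_subset ::
  "('i \<Rightarrow> 'a::{distrib_lattice, bounded_lattice} \<Rightarrow> 'a) \<Rightarrow> 'a set set \<Rightarrow> bool" where
  "theta_subset phi Y \<longleftrightarrow> Y \<subseteq> prime_spectrum \<and>
     (\<Union>i. spec_map phi i ` Y) \<subseteq> Y \<and> Y \<subseteq> spectral_top closure_of (\<Union>i. spec_map phi i ` Y)"

definition O_CS :: "('i \<Rightarrow> 'a::{distrib_lattice, bounded_lattice} \<Rightarrow> 'a) \<Rightarrow> 'a set set set" where
  "O_CS phi = {G. openin spectral_top G \<and> semimodal phi (prime_spectrum - G)}"

definition O_Ctheta :: "('i \<Rightarrow> 'a::{distrib_lattice, bounded_lattice} \<Rightarrow> 'a) \<Rightarrow> 'a set set set" where
  "O_Ctheta phi = {G. openin spectral_top G \<and> theta_subset phi (prime_spectrum - G)}"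

definition Theta_OS :: "'a::{distrib_lattice, bounded_lattice} set set \<Rightarrow> ('a \<times> 'a) set" where
  "Theta_OS G = {(a, b). sym_diff (sigma b) (sigma a) \<subseteq> G}"


section \<open>Lattices of sets ordered by inclusion\<close>

definition inclusion_order :: "'b set set \<Rightarrow> 'b set gorder" where
  "inclusion_order S = \<lparr>carrier = S, eq = (=), le = (\<subseteq>)\<rparr>"

definition lattice_iso :: "'b gorder \<Rightarrow> 'c gorder \<Rightarrow> ('b \<Rightarrow> 'c) \<Rightarrow> bool" where
  "lattice_iso L M h \<longleftrightarrow> Lattice.lattice L \<and> Lattice.lattice M \<and>
     bij_betw h (carrier L) (carrier M) \<and> join_pres L M h \<and> meet_pres L M h"

end

theory Submission
  imports Defs
begin

text \<open>
  By the prime filter theorem for quotients, \<open>G \<mapsto> Theta_OS G\<close> is an inclusion-preserving and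
  inclusion-reflecting bijection from the open sets of the Priestley space onto the congruences of
  the bounded distributive lattice: \<open>Theta_OS G\<close> identifies \<open>a\<close> and \<open>b\<close> when they lie in the same
  prime filters outside \<open>G\<close>.  It remains to match the two restrictions.  Let \<open>Y\<close> be the closed
  complement of \<open>G\<close> and \<open>U\<close> the union of the sets \<open>f\<^sub>i(Y)\<close>.  Applying every \<open>\<phi>\<^sub>i\<close> to \<open>a\<close> and \<open>b\<close>
  amounts to comparing them on \<open>U\<close> instead of \<open>Y\<close>, and agreement on a set is the same as agreement
  on its closure.  Hence compatibility with the \<open>\<phi>\<^sub>i\<close> means \<open>U \<subseteq> Y\<close>, and the \<open>\<theta>\<close>-condition means
  \<open>cl U = Y\<close>.  That the posets are lattices follows since both kinds of congruences are closed
  under intersections.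
\<close>

section \<open>Isomorphisms of inclusion orders\<close>

lemma carrier_inclusion_order [simp]: "carrier (inclusion_order S) = S"
  by (simp add: inclusion_order_def)

lemma le_inclusion_order [simp]: "A \<sqsubseteq>\<^bsub>inclusion_order S\<^esub> B \<longleftrightarrow> A \<subseteq> B"
  by (simp add: inclusion_order_def)

lemma partial_order_inclusion_order: "partial_order (inclusion_order S)"
  by unfold_locales (auto simp: inclusion_order_def)

lemma Upper_inclusion_order:
  assumes "A \<in> S" "B \<in> S"
  shows "Upper (inclusion_order S) {A, B} = {C \<in> S. A \<subseteq> C \<and> B \<subseteq> C}"
  using assms by (intro Set.set_eqI) (simp add: Upper_def all_conj_distrib conj_commute)

lemma Lower_inclusion_order:
  assumes "A \<in> S" "B \<in> S"
  shows "Lower (inclusion_order S) {A, B} = {C \<in> S. C \<subseteq> A \<and> C \<subseteq> B}"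
  using assms by (intro Set.set_eqI) (simp add: Lower_def all_conj_distrib conj_commute)

lemma least_Upper_inclusion_order:
  assumes "A \<in> S" "B \<in> S"
  shows "least (inclusion_order S) C (Upper (inclusion_order S) {A, B}) \<longleftrightarrow>
    C \<in> S \<and> A \<subseteq> C \<and> B \<subseteq> C \<and> (\<forall>D\<in>S. A \<subseteq> D \<longrightarrow> B \<subseteq> D \<longrightarrow> C \<subseteq> D)"
  by (simp add: least_def Upper_inclusion_order[OF assms] Ball_def imp_conjL)

lemma greatest_Lower_inclusion_order:
  assumes "A \<in> S" "B \<in> S"
  shows "greatest (inclusion_order S) C (Lower (inclusion_order S) {A, B}) \<longleftrightarrow>
    C \<in> S \<and> C \<subseteq> A \<and> C \<subseteq> B \<and> (\<forall>D\<in>S. D \<subseteq> A \<longrightarrow> D \<subseteq> B \<longrightarrow> D \<subseteq> C)"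
  by (simp add: greatest_def Lower_inclusion_order[OF assms] Ball_def imp_conjL)

lemma lattice_inclusion_orderI:
  assumes "\<And>A B. A \<in> S \<Longrightarrow> B \<in> S \<Longrightarrow>
      \<exists>C. least (inclusion_order S) C (Upper (inclusion_order S) {A, B})"
    and "\<And>A B. A \<in> S \<Longrightarrow> B \<in> S \<Longrightarrow>
      \<exists>C. greatest (inclusion_order S) C (Lower (inclusion_order S) {A, B})"
  shows "Lattice.lattice (inclusion_order S)"
  using assms partial_order_inclusion_order[of S]
  by (simp add: Lattice.lattice_def upper_semilattice_def lower_semilattice_def
      upper_semilattice_axioms_def lower_semilattice_axioms_def)

text \<open>Meets are intersections, and the join of two members is the intersection of all members
  above both. Congruences thus form a lattice without any description of generated
  congruences.\<close>

lemma lattice_closure_system: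
  assumes Inter: "\<And>\<A>. \<A> \<subseteq> S \<Longrightarrow> \<Inter>\<A> \<in> S"
  shows "Lattice.lattice (inclusion_order S)"
proof (rule lattice_inclusion_orderI)
  fix A B assume AB: "A \<in> S" "B \<in> S"
  have "\<Inter>{D \<in> S. A \<subseteq> D \<and> B \<subseteq> D} \<in> S"
    by (rule Inter) blast
  then have "least (inclusion_order S) (\<Inter>{D \<in> S. A \<subseteq> D \<and> B \<subseteq> D}) (Upper (inclusion_order S) {A, B})"
    unfolding least_Upper_inclusion_order[OF AB] by blast
  then show "\<exists>C. least (inclusion_order S) C (Upper (inclusion_order S) {A, B})" ..
  have "\<Inter>{A, B} \<in> S"
    using AB by (intro Inter) blast
  then have "greatest (inclusion_order S) (\<Inter>{A, B}) (Lower (inclusion_order S) {A, B})"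
    unfolding greatest_Lower_inclusion_order[OF AB] by blast
  then show "\<exists>C. greatest (inclusion_order S) C (Lower (inclusion_order S) {A, B})" ..
qed

text \<open>The join is defined by Hilbert choice of a least upper bound, so uniqueness of least
  elements is what identifies it.\<close>

lemma join_inclusion_order_eqI:
  assumes "A \<in> S" "B \<in> S" "least (inclusion_order S) C (Upper (inclusion_order S) {A, B})"
  shows "A \<squnion>\<^bsub>inclusion_order S\<^esub> B = C"
proof -
  interpret partial_order "inclusion_order S"
    by (rule partial_order_inclusion_order)
  show ?thesis
    unfolding join_def Lattice.sup_def
    by (rule some_equality, rule assms(3)) (rule least_unique[OF _ assms(3)])
qed

lemma meet_inclusion_order_eqI:
  assumes "A \<in> S" "B \<in> S" "greatest (inclusion_order S) C (Lower (inclusion_order S) {A, B})"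
  shows "A \<sqinter>\<^bsub>inclusion_order S\<^esub> B = C"
proof -
  interpret partial_order "inclusion_order S"
    by (rule partial_order_inclusion_order)
  show ?thesis
    unfolding meet_def Lattice.inf_def
    by (rule some_equality, rule assms(3)) (rule greatest_unique[OF _ assms(3)])
qed

text \<open>Since \<open>h\<close> is onto \<open>T\<close> and both preserves and reflects
  inclusion, least upper and greatest lower bounds correspond in both directions. Read from
  \<open>T\<close> to \<open>S\<close>, this makes \<open>S\<close> a lattice; read from
  \<open>S\<close> to \<open>T\<close>, it gives preservation of joins and meets.\<close>

lemma lattice_iso_inclusion_order:
  assumes bij: "bij_betw h S T"
    and mono: "\<And>A B. A \<in> S \<Longrightarrow> B \<in> S \<Longrightarrow> h A \<subseteq> h B \<longleftrightarrow> A \<subseteq> B"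
    and T: "Lattice.lattice (inclusion_order T)"
  shows "lattice_iso (inclusion_order S) (inclusion_order T) h"
proof -
  have img: "T = h ` S"
    using bij by (simp add: bij_betw_def)
  have least_iff: "least (inclusion_order T) (h C) (Upper (inclusion_order T) {h A, h B}) \<longleftrightarrow>
      least (inclusion_order S) C (Upper (inclusion_order S) {A, B})"
    if "A \<in> S" "B \<in> S" "C \<in> S" for A B C
    using that mono by (simp add: img least_Upper_inclusion_order)
  have greatest_iff: "greatest (inclusion_order T) (h C) (Lower (inclusion_order T) {h A, h B}) \<longleftrightarrow>
      greatest (inclusion_order S) C (Lower (inclusion_order S) {A, B})"
    if "A \<in> S" "B \<in> S" "C \<in> S" for A B C
    using that mono by (simp add: img greatest_Lower_inclusion_order)
  have join: "\<exists>C\<in>S. least (inclusion_order S) C (Upper (inclusion_order S) {A, B})"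
    and meet: "\<exists>C\<in>S. greatest (inclusion_order S) C (Lower (inclusion_order S) {A, B})"
    if AB: "A \<in> S" "B \<in> S" for A B
  proof -
    interpret T: Lattice.lattice "inclusion_order T"
      by (rule T)
    have hAB: "h A \<in> T" "h B \<in> T"
      using AB img by auto
    obtain D where D: "least (inclusion_order T) D (Upper (inclusion_order T) {h A, h B})"
      using T.sup_of_two_exists hAB by auto
    then obtain C where "C \<in> S" "D = h C"
      using img least_closed[OF D] by auto
    then show "\<exists>C\<in>S. least (inclusion_order S) C (Upper (inclusion_order S) {A, B})"
      using D least_iff AB by blast
    obtain D where D: "greatest (inclusion_order T) D (Lower (inclusion_order T) {h A, h B})"
      using T.inf_of_two_exists hAB by auto
    then obtain C where "C \<in> S" "D = h C"
      using img greatest_closed[OF D] by auto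
    then show "\<exists>C\<in>S. greatest (inclusion_order S) C (Lower (inclusion_order S) {A, B})"
      using D greatest_iff AB by blast
  qed
  have S: "Lattice.lattice (inclusion_order S)"
    by (rule lattice_inclusion_orderI) (meson join, meson meet)
  have "h (A \<squnion>\<^bsub>inclusion_order S\<^esub> B) = h A \<squnion>\<^bsub>inclusion_order T\<^esub> h B"
    if AB: "A \<in> S" "B \<in> S" for A B
  proof -
    obtain C where C: "C \<in> S" "least (inclusion_order S) C (Upper (inclusion_order S) {A, B})"
      using join[OF AB] by blast
    then have "least (inclusion_order T) (h C) (Upper (inclusion_order T) {h A, h B})"
      using least_iff AB by blast
    then show ?thesis
      using AB C img by (simp add: join_inclusion_order_eqI)
  qed
  moreover have "h (A \<sqinter>\<^bsub>inclusion_order S\<^esub> B) = h A \<sqinter>\<^bsub>inclusion_order T\<^esub> h B"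
    if AB: "A \<in> S" "B \<in> S" for A B
  proof -
    obtain C where C: "C \<in> S" "greatest (inclusion_order S) C (Lower (inclusion_order S) {A, B})"
      using meet[OF AB] by blast
    then have "greatest (inclusion_order T) (h C) (Lower (inclusion_order T) {h A, h B})"
      using greatest_iff AB by blast
    then show ?thesis
      using AB C img by (simp add: meet_inclusion_order_eqI)
  qed
  ultimately show ?thesis
    using S T bij by (simp add: lattice_iso_def join_pres_def meet_pres_def)
qed


section \<open>The prime filter theorem modulo a congruence\<close>

lemma lattice_congruence_equiv:
  assumes "lattice_congruence R"
  shows lattice_congruence_refl: "(x, x) \<in> R"
    and lattice_congruence_sym: "(x, y) \<in> R \<Longrightarrow> (y, x) \<in> R"
    and lattice_congruence_trans: "(x, y) \<in> R \<Longrightarrow> (y, z) \<in> R \<Longrightarrow> (x, z) \<in> R"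
    and lattice_congruence_sup: "(x, x') \<in> R \<Longrightarrow> (y, y') \<in> R \<Longrightarrow> (sup x y, sup x' y') \<in> R"
    and lattice_congruence_inf: "(x, x') \<in> R \<Longrightarrow> (y, y') \<in> R \<Longrightarrow> (inf x y, inf x' y') \<in> R"
  using assms unfolding lattice_congruence_def equiv_def
  by (auto intro: refl_onD dest: symD transD)

lemma prime_filter_inf: "prime_filter P \<Longrightarrow> inf x y \<in> P \<longleftrightarrow> x \<in> P \<and> y \<in> P"
  unfolding prime_filter_def by (meson inf_le1 inf_le2)

lemma prime_filter_sup: "prime_filter P \<Longrightarrow> sup x y \<in> P \<longleftrightarrow> x \<in> P \<or> y \<in> P"
  unfolding prime_filter_def by (meson sup_ge1 sup_ge2)

lemma prime_filter_mono: "prime_filter P \<Longrightarrow> x \<in> P \<Longrightarrow> x \<le> y \<Longrightarrow> y \<in> P"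
  unfolding prime_filter_def by blast

lemma prime_filter_top: "prime_filter P \<Longrightarrow> Orderings.top \<in> P"
  by (simp add: prime_filter_def)

lemma prime_filter_bot: "prime_filter P \<Longrightarrow> bot \<notin> P"
  unfolding prime_filter_def by (metis UNIV_eq_I bot_least)

text \<open>The preimages of the filters of the quotient by \<open>R\<close>.\<close>

definition congruence_filter :: "('a::{distrib_lattice, bounded_lattice} \<times> 'a) set \<Rightarrow> 'a set \<Rightarrow> bool" where
  "congruence_filter R F \<longleftrightarrow> (\<forall>x y. x \<in> F \<and> x \<le> y \<longrightarrow> y \<in> F) \<and>
     (\<forall>x y. x \<in> F \<and> y \<in> F \<longrightarrow> inf x y \<in> F) \<and> (\<forall>x y. (x, y) \<in> R \<and> x \<in> F \<longrightarrow> y \<in> F)"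

text \<open>The pair in \<open>R\<close> says that the meet of \<open>f\<close> and \<open>x\<close>
  lies below \<open>z\<close> in the quotient. For nonempty \<open>F\<close> the set is therefore
  the preimage of the quotient filter generated by \<open>F\<close> and \<open>x\<close>.\<close>

lemma congruence_filter_extend:
  assumes R: "lattice_congruence R" and F: "congruence_filter R F"
  shows "congruence_filter R {z. \<exists>f\<in>F. (inf (inf f x) z, inf f x) \<in> R}" (is "congruence_filter R ?E")
  unfolding congruence_filter_def
proof (intro conjI allI impI; elim conjE)
  fix z w assume "z \<in> ?E" "z \<le> w"
  then obtain f where f: "f \<in> F" "(inf (inf f x) z, inf f x) \<in> R"
    by blast
  have "(inf (inf (inf f x) z) w, inf (inf f x) w) \<in> R"
    using lattice_congruence_inf[OF R f(2) lattice_congruence_refl[OF R, of w]] .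
  moreover have "inf (inf (inf f x) z) w = inf (inf f x) z"
    using \<open>z \<le> w\<close> by (simp add: inf.absorb1 inf_assoc)
  ultimately have "(inf (inf f x) w, inf f x) \<in> R"
    using f(2) R by (metis lattice_congruence_sym lattice_congruence_trans)
  then show "w \<in> ?E"
    using f(1) by blast
next
  fix z w assume "z \<in> ?E" "w \<in> ?E"
  then obtain f g where f: "f \<in> F" "(inf (inf f x) z, inf f x) \<in> R"
    and g: "g \<in> F" "(inf (inf g x) w, inf g x) \<in> R"
    by blast
  have "(inf (inf (inf f x) z) (inf (inf g x) w), inf (inf f x) (inf g x)) \<in> R"
    by (rule lattice_congruence_inf[OF R f(2) g(2)])
  moreover have "inf (inf (inf f x) z) (inf (inf g x) w) = inf (inf (inf f g) x) (inf z w)"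
    "inf (inf f x) (inf g x) = inf (inf f g) x"
    by (simp_all add: inf_aci)
  moreover have "inf f g \<in> F"
    using F f(1) g(1) unfolding congruence_filter_def by blast
  ultimately show "inf z w \<in> ?E"
    by (intro CollectI bexI[of _ "inf f g"]) simp_all
next
  fix z w assume zw: "(z, w) \<in> R" "z \<in> ?E"
  then obtain f where f: "f \<in> F" "(inf (inf f x) z, inf f x) \<in> R"
    by blast
  have "(inf (inf f x) w, inf (inf f x) z) \<in> R"
    by (rule lattice_congruence_inf[OF R lattice_congruence_refl[OF R] lattice_congruence_sym[OF R zw(1)]])
  then show "w \<in> ?E"
    using f lattice_congruence_trans[OF R, of "inf (inf f x) w"] by blast
qed

text \<open>The hypothesis on \<open>a\<close> and \<open>b\<close> says that \<open>a\<close> is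
  not below \<open>b\<close> in the quotient. Zorn's lemma gives a congruence filter maximal among
  those containing \<open>a\<close> and missing \<open>b\<close>, and distributivity makes it prime.
  Working with \<open>R\<close>-saturated subsets of the algebra replaces forming the
  quotient.\<close>

lemma ex_prime_congruence_filter:
  assumes R: "lattice_congruence R" and ab: "(inf a b, a) \<notin> R"
  obtains P where "prime_filter P" "\<And>x y. (x, y) \<in> R \<Longrightarrow> x \<in> P \<longleftrightarrow> y \<in> P" "a \<in> P" "b \<notin> P"
proof -
  define \<F> where "\<F> = {F. congruence_filter R F \<and> a \<in> F \<and> b \<notin> F}"
  \<comment> \<open>A member of \<open>\<F>\<close> to start from: extending the class of the top
    element by \<open>a\<close> yields the preimage of the principal filter of \<open>a\<close> in
    the quotient.\<close>
  have "congruence_filter R {x. (x, Orderings.top) \<in> R}"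
    unfolding congruence_filter_def
  proof (intro conjI allI impI; elim conjE; unfold mem_Collect_eq)
    fix x y :: 'a assume "(x, Orderings.top) \<in> R" "x \<le> y"
    then show "(y, Orderings.top) \<in> R"
      using lattice_congruence_sup[OF R _ lattice_congruence_refl[OF R, of y], of x Orderings.top]
      by (simp add: sup.absorb2)
  next
    fix x y assume "(x, Orderings.top) \<in> R" "(y, Orderings.top) \<in> R"
    then show "(inf x y, Orderings.top) \<in> R"
      using lattice_congruence_inf[OF R, of x Orderings.top y Orderings.top] by simp
  next
    fix x y assume "(x, y) \<in> R" "(x, Orderings.top) \<in> R"
    then show "(y, Orderings.top) \<in> R"
      using lattice_congruence_sym[OF R] lattice_congruence_trans[OF R] by blast
  qed
  from congruence_filter_extend[OF R this, of a]
  have "congruence_filter R {z. \<exists>f\<in>{x. (x, Orderings.top) \<in> R}. (inf (inf f a) z, inf f a) \<in> R}"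
    (is "congruence_filter R ?E") .
  moreover have "a \<in> ?E"
    using lattice_congruence_refl[OF R] by (auto simp: inf_assoc)
  moreover have "b \<notin> ?E"
  proof
    assume "b \<in> ?E"
    then obtain f where f: "(f, Orderings.top) \<in> R" "(inf (inf f a) b, inf f a) \<in> R"
      by blast
    \<comment> \<open>As \<open>f\<close> is congruent to the top, it can be cancelled from meets
      modulo \<open>R\<close>, so \<open>b\<close> in the extension would put \<open>a\<close> below
      \<open>b\<close> in the quotient.\<close>
    have fa: "(inf f x, x) \<in> R" for x
      using lattice_congruence_inf[OF R f(1) lattice_congruence_refl[OF R, of x]] by simp
    show False
      using ab f(2) fa[of a] fa[of "inf a b"] R
      by (metis inf_assoc lattice_congruence_sym lattice_congruence_trans)
  qed
  ultimately have "?E \<in> \<F>"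
    by (simp add: \<F>_def)
  then have "\<F> \<noteq> {}"
    by blast
  moreover have "\<Union>\<C> \<in> \<F>" if ne: "\<C> \<noteq> {}" and ch: "subset.chain \<F> \<C>" for \<C>
  proof -
    have mem: "congruence_filter R F" "a \<in> F" "b \<notin> F" if "F \<in> \<C>" for F
      using ch that by (auto simp: subset.chain_def \<F>_def)
    have "inf x y \<in> \<Union>\<C>" if "x \<in> \<Union>\<C>" "y \<in> \<Union>\<C>" for x y
    proof -
      obtain F G where "F \<in> \<C>" "G \<in> \<C>" "x \<in> F" "y \<in> G"
        using \<open>x \<in> \<Union>\<C>\<close> \<open>y \<in> \<Union>\<C>\<close> by blast
      moreover have "F \<subseteq> G \<or> G \<subseteq> F"
        using ch calculation by (auto simp: subset_chain_def)
      ultimately show ?thesis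
        using mem(1) unfolding congruence_filter_def by blast
    qed
    moreover have "y \<in> \<Union>\<C>" if "x \<in> \<Union>\<C>" "x \<le> y \<or> (x, y) \<in> R" for x y
    proof -
      obtain F where "F \<in> \<C>" "x \<in> F"
        using \<open>x \<in> \<Union>\<C>\<close> by blast
      then have "y \<in> F"
        using mem(1)[of F] that(2) unfolding congruence_filter_def by blast
      then show ?thesis
        using \<open>F \<in> \<C>\<close> by blast
    qed
    ultimately have "congruence_filter R (\<Union>\<C>)"
      unfolding congruence_filter_def by meson
    then show ?thesis
      using mem ne unfolding \<F>_def by auto
  qed
  ultimately obtain P where P: "P \<in> \<F>" and max: "\<And>F. F \<in> \<F> \<Longrightarrow> P \<subseteq> F \<Longrightarrow> F = P"
    using subset_Zorn_nonempty[of \<F>] by metis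
  have filt: "congruence_filter R P" and a: "a \<in> P" and b: "b \<notin> P"
    using P by (auto simp: \<F>_def)
  have upD: "x \<in> P \<Longrightarrow> x \<le> y \<Longrightarrow> y \<in> P" and infD: "x \<in> P \<Longrightarrow> y \<in> P \<Longrightarrow> inf x y \<in> P"
    and satD: "(x, y) \<in> R \<Longrightarrow> x \<in> P \<Longrightarrow> y \<in> P" for x y
    using filt unfolding congruence_filter_def by blast+
  \<comment> \<open>Extending \<open>P\<close> by a new element \<open>x\<close> must capture
    \<open>b\<close>; otherwise the extension would belong to \<open>\<F>\<close>, so maximality
    would force it to equal \<open>P\<close>, although it contains \<open>x\<close>.\<close>
  have reach: "\<exists>f\<in>P. (inf (inf f x) b, inf f x) \<in> R" if "x \<notin> P" for x
  proof (rule ccontr)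
    let ?E = "{z. \<exists>f\<in>P. (inf (inf f x) z, inf f x) \<in> R}"
    assume "\<not> ?thesis"
    then have "b \<notin> ?E"
      by blast
    moreover have "P \<subseteq> ?E"
    proof
      fix z assume "z \<in> P"
      moreover have "inf (inf z x) z = inf z x"
        by (simp add: inf.absorb1 le_infI1)
      ultimately show "z \<in> ?E"
        using lattice_congruence_refl[OF R] by (intro CollectI bexI[of _ z]) auto
    qed
    moreover have "congruence_filter R ?E"
      by (rule congruence_filter_extend[OF R filt])
    ultimately have "?E = P"
      using a by (intro max) (auto simp: \<F>_def)
    moreover have "x \<in> ?E"
      using a lattice_congruence_refl[OF R] by (intro CollectI bexI[of _ a]) (auto simp: inf_assoc)
    ultimately show False
      using that by blast
  qed
  have "x \<in> P \<or> y \<in> P" if "sup x y \<in> P" for x y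
  proof (rule ccontr)
    assume "\<not> ?thesis"
    then obtain f g where f: "f \<in> P" "(inf (inf f x) b, inf f x) \<in> R"
      and g: "g \<in> P" "(inf (inf g y) b, inf g y) \<in> R"
      using reach by meson
    \<comment> \<open>Meeting the two relations with \<open>g\<close> and \<open>f\<close> brings
      both to the common factor \<open>?h\<close>. By distributivity their join says that the meet
      of \<open>?h\<close> with \<open>sup x y\<close> is below \<open>b\<close> modulo
      \<open>R\<close>; this meet is in \<open>P\<close>, which forces \<open>b\<close> into
      \<open>P\<close>.\<close>
    let ?h = "inf f g"
    have "(inf g (inf (inf f x) b), inf g (inf f x)) \<in> R" "(inf f (inf (inf g y) b), inf f (inf g y)) \<in> R"
      by (rule lattice_congruence_inf[OF R lattice_congruence_refl[OF R] f(2)],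
          rule lattice_congruence_inf[OF R lattice_congruence_refl[OF R] g(2)])
    from lattice_congruence_sup[OF R this]
    have "(inf (inf ?h (sup x y)) b, inf ?h (sup x y)) \<in> R"
      by (simp add: inf_sup_distrib1 inf_sup_distrib2 inf_aci)
    moreover have "inf ?h (sup x y) \<in> P"
      using f(1) g(1) that infD by blast
    ultimately have "inf (inf ?h (sup x y)) b \<in> P"
      using satD lattice_congruence_sym[OF R] by blast
    then show False
      using b upD by (meson inf_le2)
  qed
  then have "prime_filter P"
    unfolding prime_filter_def using a b upD infD top_greatest by blast
  moreover have "x \<in> P \<longleftrightarrow> y \<in> P" if "(x, y) \<in> R" for x y
    using that satD lattice_congruence_sym[OF R] by blast
  ultimately show thesis
    using that a b by blast
qed


section \<open>Open sets and lattice congruences\<close>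

lemma mem_prime_spectrum: "P \<in> prime_spectrum \<longleftrightarrow> prime_filter P"
  by (simp add: prime_spectrum_def)

lemma mem_sigma: "P \<in> sigma a \<longleftrightarrow> prime_filter P \<and> a \<in> P"
  by (simp add: sigma_def mem_prime_spectrum)

lemma Theta_OS_iff:
  "(a, b) \<in> Theta_OS G \<longleftrightarrow> (\<forall>P. prime_filter P \<longrightarrow> P \<notin> G \<longrightarrow> (a \<in> P \<longleftrightarrow> b \<in> P))"
  by (auto simp: Theta_OS_def mem_sigma)

text \<open>Membership in a prime filter is a lattice homomorphism onto the two-element chain; the
  relation is the intersection of the kernels of those given by prime filters outside
  \<open>G\<close>.\<close>

lemma lattice_congruence_Theta_OS: "lattice_congruence (Theta_OS G)"
  unfolding lattice_congruence_def
  by (auto simp: Theta_OS_iff prime_filter_inf prime_filter_sup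
      intro!: equivI refl_onI symI transI)

lemma openin_sigma_diff: "openin spectral_top (sigma a - sigma b)"
proof -
  have "openin spectral_top (sigma a)" "openin spectral_top (prime_spectrum - sigma b)"
    unfolding spectral_top_def by (auto intro: topology_generated_by_Basis)
  then have "openin spectral_top (sigma a \<inter> (prime_spectrum - sigma b))"
    by (rule openin_Int)
  moreover have "sigma a \<inter> (prime_spectrum - sigma b) = sigma a - sigma b"
    by (auto simp: sigma_def)
  ultimately show ?thesis
    by simp
qed

text \<open>The sets \<open>sigma a - sigma b\<close> form a basis: the subbasic sets are the cases
  \<open>b = bot\<close> and \<open>a = top\<close>, and an intersection of two such sets has the
  same form, by meets on the left and joins on the right.\<close>

lemma openin_spectral_topE:
  assumes "openin spectral_top G" "P \<in> G"
  obtains a b where "P \<in> sigma a - sigma b" "sigma a - sigma b \<subseteq> G"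
proof -
  have "generate_topology_on (range sigma \<union> range (\<lambda>a. prime_spectrum - sigma a)) G"
    using assms(1) by (simp add: spectral_top_def openin_topology_generated_by_iff)
  then have "P \<in> G \<Longrightarrow> \<exists>a b. P \<in> sigma a - sigma b \<and> sigma a - sigma b \<subseteq> G" for P
  proof (induction arbitrary: P)
    case Empty
    then show ?case by simp
  next
    case (Int U V)
    obtain a b c d where "P \<in> sigma a - sigma b" "sigma a - sigma b \<subseteq> U"
      "P \<in> sigma c - sigma d" "sigma c - sigma d \<subseteq> V"
      using Int by blast
    moreover have "sigma (inf a c) - sigma (sup b d) = (sigma a - sigma b) \<inter> (sigma c - sigma d)"
      by (auto simp: mem_sigma prime_filter_inf prime_filter_sup)
    ultimately show ?case
      by blast
  next
    case (UN K)
    then show ?case by blast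
  next
    case (Basis S)
    then consider a where "S = sigma a" | b where "S = prime_spectrum - sigma b"
      by blast
    then show ?case
    proof cases
      case 1
      then show ?thesis
        using Basis.prems prime_filter_bot
        by (intro exI[of _ a] exI[of _ bot]) (auto simp: mem_sigma)
    next
      case 2
      then show ?thesis
        using Basis.prems prime_filter_top
        by (intro exI[of _ Orderings.top] exI[of _ b]) (auto simp: mem_sigma mem_prime_spectrum)
    qed
  qed
  then show thesis
    using assms(2) that by blast
qed

text \<open>A basic neighbourhood \<open>sigma a - sigma b\<close> is exactly the symmetric
  difference of \<open>sigma a\<close> and \<open>sigma (inf a b)\<close>. So the pair
  \<open>(a, inf a b)\<close> encodes it, and an open set is recovered from the pairs it
  identifies.\<close>

lemma Theta_OS_subset_iff:
  assumes A: "openin spectral_top A"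
  shows "Theta_OS A \<subseteq> Theta_OS B \<longleftrightarrow> A \<subseteq> B"
proof
  assume le: "Theta_OS A \<subseteq> Theta_OS B"
  show "A \<subseteq> B"
  proof
    fix P assume "P \<in> A"
    then obtain a b where ab: "P \<in> sigma a - sigma b" "sigma a - sigma b \<subseteq> A"
      using openin_spectral_topE[OF A] by blast
    then have "(a, inf a b) \<in> Theta_OS A"
      by (auto simp: Theta_OS_iff prime_filter_inf mem_sigma)
    then have "(a, inf a b) \<in> Theta_OS B"
      using le by blast
    then show "P \<in> B"
      using ab(1) by (auto simp: Theta_OS_iff prime_filter_inf mem_sigma)
  qed
next
  assume "A \<subseteq> B"
  then show "Theta_OS A \<subseteq> Theta_OS B"
    by (auto simp: Theta_OS_def)
qed

text \<open>The witness consists of the prime filters that separate some \<open>R\<close>-related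
  pair. Those left outside are the \<open>R\<close>-saturated ones, and by the prime filter theorem
  they suffice to separate elements that are not congruent.\<close>

lemma ex_open_Theta_OS_eq:
  assumes R: "lattice_congruence R"
  obtains G where "openin spectral_top G" "Theta_OS G = R"
proof
  let ?G = "\<Union>(a, b)\<in>R. sym_diff (sigma a) (sigma b)"
  show "openin spectral_top ?G"
    by (auto intro!: openin_Union openin_Un openin_sigma_diff)
  have "(a, b) \<in> Theta_OS ?G \<longleftrightarrow> (a, b) \<in> R" for a b
  proof
    assume "(a, b) \<in> R"
    then show "(a, b) \<in> Theta_OS ?G"
      by (fastforce simp: Theta_OS_iff mem_sigma)
  next
    assume ab: "(a, b) \<in> Theta_OS ?G"
    \<comment> \<open>Only an inequality modulo \<open>R\<close> is proved; using it for
      \<open>(a, b)\<close> and \<open>(b, a)\<close> gives congruence of \<open>a\<close> and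
      \<open>b\<close> through their meet.\<close>
    have "(inf a b, a) \<in> R" if ab: "(a, b) \<in> Theta_OS ?G" for a b
    proof (rule ccontr)
      assume "(inf a b, a) \<notin> R"
      then obtain P where P: "prime_filter P" "\<And>x y. (x, y) \<in> R \<Longrightarrow> x \<in> P \<longleftrightarrow> y \<in> P" "a \<in> P" "b \<notin> P"
        using ex_prime_congruence_filter[OF R] by blast
      then have "P \<notin> ?G"
        by (auto simp: mem_sigma)
      then show False
        using ab P unfolding Theta_OS_iff by blast
    qed
    from this[OF ab] this[of b a] ab show "(a, b) \<in> R"
      using lattice_congruence_sym[OF lattice_congruence_Theta_OS ab]
        lattice_congruence_sym[OF R] lattice_congruence_trans[OF R]
      by (metis inf_commute)
  qed
  then show "Theta_OS ?G = R"
    by auto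
qed

text \<open>Common frame for both isomorphisms: what remains specific to each is the matching of the
  condition on \<open>G\<close> with the condition on its congruence, and closure of the congruences
  under intersection.\<close>

lemma lattice_iso_Theta_OS:
  assumes S: "S \<subseteq> {G. openin spectral_top G}" and T: "T \<subseteq> {R. lattice_congruence R}"
    and iff: "\<And>G. openin spectral_top G \<Longrightarrow> Theta_OS G \<in> T \<longleftrightarrow> G \<in> S"
    and Inter: "\<And>\<R>. \<R> \<subseteq> T \<Longrightarrow> \<Inter>\<R> \<in> T"
  shows "lattice_iso (inclusion_order S) (inclusion_order T) Theta_OS"
proof (rule lattice_iso_inclusion_order)
  show mono: "Theta_OS A \<subseteq> Theta_OS B \<longleftrightarrow> A \<subseteq> B" if "A \<in> S" "B \<in> S" for A B
    using that S by (intro Theta_OS_subset_iff) blast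
  show "Lattice.lattice (inclusion_order T)"
    by (rule lattice_closure_system) (rule Inter)
  show "bij_betw Theta_OS S T"
    unfolding bij_betw_def
  proof
    show "inj_on Theta_OS S"
      using mono by (intro inj_onI subset_antisym) blast+
    show "Theta_OS ` S = T"
    proof
      show "Theta_OS ` S \<subseteq> T"
        using S iff by blast
      show "T \<subseteq> Theta_OS ` S"
      proof
        fix R assume "R \<in> T"
        then obtain G where "openin spectral_top G" "Theta_OS G = R"
          using T ex_open_Theta_OS_eq by blast
        then show "R \<in> Theta_OS ` S"
          using iff \<open>R \<in> T\<close> by blast
      qed
    qed
  qed
qed

section \<open>Closure of the classes of congruences under intersection\<close>

lemma lattice_congruence_Inter:
  assumes "\<And>R. R \<in> \<R> \<Longrightarrow> lattice_congruence R"
  shows "lattice_congruence (\<Inter>\<R>)"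
  unfolding lattice_congruence_def
proof (intro conjI allI impI)
  show "equiv UNIV (\<Inter>\<R>)"
  proof (rule equivI)
    show "refl (\<Inter>\<R>)"
      using lattice_congruence_refl assms by (fast intro: refl_onI)
    show "sym (\<Inter>\<R>)"
      using lattice_congruence_sym assms by (fast intro: symI)
    show "trans (\<Inter>\<R>)"
      using lattice_congruence_trans assms by (fast intro: transI)
  qed simp
  fix x x' y y' assume xy: "(x, x') \<in> \<Inter>\<R> \<and> (y, y') \<in> \<Inter>\<R>"
  show "(sup x y, sup x' y') \<in> \<Inter>\<R>"
    using xy lattice_congruence_sup assms by fast
  show "(inf x y, inf x' y') \<in> \<Inter>\<R>"
    using xy lattice_congruence_inf assms by fast
qed

lemma lm_congruence_lattice_congruence: "lm_congruence phi phibar R \<Longrightarrow> lattice_congruence R"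
  by (simp add: lm_congruence_def)

lemma theta_congruence_lattice_congruence: "theta_congruence phi R \<Longrightarrow> lattice_congruence R"
  unfolding theta_congruence_def by blast

lemma lm_congruence_Inter:
  assumes "\<And>R. R \<in> \<R> \<Longrightarrow> lm_congruence phi phibar R"
  shows "lm_congruence phi phibar (\<Inter>\<R>)"
proof -
  have "lattice_congruence (\<Inter>\<R>)"
    by (rule lattice_congruence_Inter) (rule lm_congruence_lattice_congruence[OF assms])
  moreover have "(phi i x, phi i y) \<in> R \<and> (phibar i x, phibar i y) \<in> R"
    if "(x, y) \<in> R" "R \<in> \<R>" for R i x y
    using assms[OF that(2)] that(1) by (simp add: lm_congruence_def)
  ultimately show ?thesis
    unfolding lm_congruence_def by simp
qed

lemma theta_congruence_iff:
  "theta_congruence phi R \<Longrightarrow> (x, y) \<in> R \<longleftrightarrow> (\<forall>i. (phi i x, phi i y) \<in> R)"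
  unfolding theta_congruence_def by blast

text \<open>The equivalence survives intersection because the quantifiers over relations and over
  indices are both universal and commute.\<close>

lemma theta_congruence_Inter:
  assumes "\<And>R. R \<in> \<R> \<Longrightarrow> theta_congruence phi R"
  shows "theta_congruence phi (\<Inter>\<R>)"
proof -
  have "lattice_congruence (\<Inter>\<R>)"
    by (rule lattice_congruence_Inter) (rule theta_congruence_lattice_congruence[OF assms])
  moreover have "(\<forall>R\<in>\<R>. (x, y) \<in> R) \<longleftrightarrow> (\<forall>R\<in>\<R>. \<forall>i. (phi i x, phi i y) \<in> R)" for x y
    by (intro ball_cong refl theta_congruence_iff assms)
  then have "(x, y) \<in> \<Inter>\<R> \<longleftrightarrow> (\<forall>i. (phi i x, phi i y) \<in> \<Inter>\<R>)" for x y
    unfolding Inter_iff by blast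
  ultimately show ?thesis
    unfolding theta_congruence_def by blast
qed


section \<open>Congruences of Lukasiewicz--Moisil algebras\<close>

context lm_algebra
begin

lemma phi_mono: "x \<le> y \<Longrightarrow> phi i x \<le> phi i y"
  by (metis L1_inf inf.absorb_iff1)

text \<open>This makes each \<open>spec_map phi i\<close> a self-map of the prime spectrum;
  properness of the preimage comes from \<open>phi i bot = bot\<close>.\<close>

lemma prime_filter_spec_map: "prime_filter P \<Longrightarrow> prime_filter (spec_map phi i P)"
proof -
  assume P: "prime_filter P"
  have "bot \<notin> phi i -` P"
    using P by (simp add: L1_bot prime_filter_bot)
  then have "phi i -` P \<noteq> UNIV"
    by blast
  then show ?thesis
    using P unfolding spec_map_def prime_filter_def[of "phi i -` P"]
    by (auto simp: L1_inf L1_sup L1_top prime_filter_inf prime_filter_sup prime_filter_top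
        intro: prime_filter_mono[OF _ _ phi_mono])
qed

text \<open>A prime filter contains exactly one of two complementary elements. Through this,
  compatibility with \<open>phibar\<close> follows from compatibility with
  \<open>phi\<close>.\<close>

lemma phibar_mem_iff:
  assumes "prime_filter P"
  shows "phibar i x \<in> P \<longleftrightarrow> phi i x \<notin> P"
  using assms L2_inf[of i x] L2_sup[of i x] prime_filter_inf[OF assms, of "phi i x" "phibar i x"]
    prime_filter_sup[OF assms, of "phi i x" "phibar i x"]
  by (auto simp: prime_filter_top prime_filter_bot)

lemma semimodal_compl_iff:
  "semimodal phi (prime_spectrum - G) \<longleftrightarrow>
    (\<forall>i P. prime_filter P \<longrightarrow> P \<notin> G \<longrightarrow> spec_map phi i P \<notin> G)"
  using prime_filter_spec_map by (fastforce simp: semimodal_def mem_prime_spectrum)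

lemma phi_Theta_OS_iff:
  "(phi i a, phi i b) \<in> Theta_OS G \<longleftrightarrow>
    (\<forall>P. prime_filter P \<longrightarrow> P \<notin> G \<longrightarrow> (a \<in> spec_map phi i P \<longleftrightarrow> b \<in> spec_map phi i P))"
  by (simp add: Theta_OS_iff spec_map_def)

text \<open>If the image of a point \<open>P\<close> outside \<open>G\<close> fell into
  \<open>G\<close>, a basic neighbourhood of that image would give an identified pair
  \<open>(a, inf a b)\<close> whose images under \<open>phi i\<close> are separated by
  \<open>P\<close>.\<close>

lemma semimodal_if_Theta_OS_phi:
  assumes G: "openin spectral_top G"
    and phi: "\<And>i a b. (a, b) \<in> Theta_OS G \<Longrightarrow> (phi i a, phi i b) \<in> Theta_OS G"
  shows "semimodal phi (prime_spectrum - G)"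
  unfolding semimodal_compl_iff
proof (intro allI impI notI)
  fix i P assume P: "prime_filter P" "P \<notin> G" and "spec_map phi i P \<in> G"
  then obtain a b where ab: "spec_map phi i P \<in> sigma a - sigma b" "sigma a - sigma b \<subseteq> G"
    using openin_spectral_topE[OF G] by blast
  then have "(a, inf a b) \<in> Theta_OS G"
    by (auto simp: Theta_OS_iff prime_filter_inf mem_sigma)
  then have "a \<in> spec_map phi i P \<longleftrightarrow> inf a b \<in> spec_map phi i P"
    using phi P unfolding phi_Theta_OS_iff by blast
  then show False
    using ab(1) by (auto simp: mem_sigma prime_filter_inf)
qed

text \<open>For the converse direction, semimodality keeps the images of points outside
  \<open>G\<close> outside \<open>G\<close>, where identified elements already agree.\<close>

lemma lm_congruence_Theta_OS_iff:
  assumes G: "openin spectral_top G"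
  shows "lm_congruence phi phibar (Theta_OS G) \<longleftrightarrow> semimodal phi (prime_spectrum - G)"
proof
  assume "lm_congruence phi phibar (Theta_OS G)"
  then show "semimodal phi (prime_spectrum - G)"
    by (intro semimodal_if_Theta_OS_phi[OF G]) (auto simp: lm_congruence_def)
next
  assume "semimodal phi (prime_spectrum - G)"
  then have phi: "(phi i a, phi i b) \<in> Theta_OS G" if "(a, b) \<in> Theta_OS G" for i a b
    using that prime_filter_spec_map
    unfolding semimodal_compl_iff phi_Theta_OS_iff Theta_OS_iff[of a b] by blast
  moreover have "(phibar i a, phibar i b) \<in> Theta_OS G" if "(a, b) \<in> Theta_OS G" for i a b
    using phi[OF that] by (auto simp: Theta_OS_iff phibar_mem_iff)
  ultimately show "lm_congruence phi phibar (Theta_OS G)"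
    by (simp add: lm_congruence_def lattice_congruence_Theta_OS)
qed

lemma theta_congruence_Theta_OS_iff:
  assumes G: "openin spectral_top G"
  shows "theta_congruence phi (Theta_OS G) \<longleftrightarrow> theta_subset phi (prime_spectrum - G)"
proof -
  define U where "U = (\<Union>i. spec_map phi i ` (prime_spectrum - G))"
  have U_prime: "prime_filter P" if "P \<in> U" for P
    using that prime_filter_spec_map by (auto simp: U_def mem_prime_spectrum)
  have phi_iff: "(\<forall>i. (phi i a, phi i b) \<in> Theta_OS G) \<longleftrightarrow> (\<forall>P\<in>U. a \<in> P \<longleftrightarrow> b \<in> P)" for a b
    by (auto simp: phi_Theta_OS_iff U_def mem_prime_spectrum)
  have theta_subset_iff: "theta_subset phi (prime_spectrum - G) \<longleftrightarrow>
      semimodal phi (prime_spectrum - G) \<and> prime_spectrum - G \<subseteq> spectral_top closure_of U"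
    unfolding theta_subset_def semimodal_def U_def by blast
  show ?thesis
  proof
    assume theta: "theta_congruence phi (Theta_OS G)"
    then have "semimodal phi (prime_spectrum - G)"
      using theta_congruence_iff by (intro semimodal_if_Theta_OS_phi[OF G]) blast
    moreover have "P \<in> spectral_top closure_of U" if P: "P \<in> prime_spectrum - G" for P
    proof (rule ccontr)
      assume "P \<notin> spectral_top closure_of U"
      then obtain V where V: "openin spectral_top V" "P \<in> V" "V \<inter> U = {}"
        using P by (auto simp: in_closure_of topspace_spectral_top)
      then obtain a b where ab: "P \<in> sigma a - sigma b" "sigma a - sigma b \<subseteq> V"
        using openin_spectral_topE by blast
      \<comment> \<open>The neighbourhood of \<open>P\<close> misses \<open>U\<close>, so
        \<open>a\<close> and \<open>inf a b\<close> agree on \<open>U\<close>. The theta condition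
        then identifies them, yet \<open>P\<close> lies outside \<open>G\<close> and separates
        them.\<close>
      have "a \<in> Q \<longleftrightarrow> inf a b \<in> Q" if "Q \<in> U" for Q
      proof -
        have "Q \<notin> sigma a - sigma b"
          using ab(2) V(3) that by blast
        then show ?thesis
          using U_prime[OF that] by (auto simp: mem_sigma prime_filter_inf)
      qed
      then have "(a, inf a b) \<in> Theta_OS G"
        using theta_congruence_iff[OF theta] phi_iff by blast
      then show False
        using ab(1) P by (auto simp: Theta_OS_iff mem_sigma prime_filter_inf)
    qed
    ultimately show "theta_subset phi (prime_spectrum - G)"
      using theta_subset_iff by blast
  next
    assume theta: "theta_subset phi (prime_spectrum - G)"
    \<comment> \<open>A theta-subset is semimodal, so the previous equivalence supplies one
      implication of the theta condition; density of \<open>U\<close> is needed for the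
      other.\<close>
    then have "lm_congruence phi phibar (Theta_OS G)"
      using theta_subset_iff lm_congruence_Theta_OS_iff[OF G] by blast
    then have "(phi i a, phi i b) \<in> Theta_OS G" if "(a, b) \<in> Theta_OS G" for i a b
      using that by (simp add: lm_congruence_def)
    moreover have "(a, b) \<in> Theta_OS G" if agree: "\<forall>P\<in>U. a \<in> P \<longleftrightarrow> b \<in> P" for a b
      unfolding Theta_OS_iff
    proof (intro allI impI)
      fix P assume P: "prime_filter P" "P \<notin> G"
      then have cl: "P \<in> spectral_top closure_of U"
        using theta theta_subset_iff by (auto simp: mem_prime_spectrum)
      \<comment> \<open>The points separating \<open>a\<close> from \<open>b\<close> form an open
        set; if it contained the closure point \<open>P\<close>, it would meet \<open>U\<close>,
        where \<open>a\<close> and \<open>b\<close> agree.\<close>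
      have "P \<notin> sym_diff (sigma a) (sigma b)"
      proof
        assume "P \<in> sym_diff (sigma a) (sigma b)"
        moreover have "openin spectral_top (sym_diff (sigma a) (sigma b))"
          by (intro openin_Un openin_sigma_diff)
        ultimately obtain Q where Q: "Q \<in> U" "Q \<in> sym_diff (sigma a) (sigma b)"
          using cl unfolding in_closure_of by meson
        then show False
          using bspec[OF agree Q(1)] by (auto simp: mem_sigma)
      qed
      then show "a \<in> P \<longleftrightarrow> b \<in> P"
        using P by (simp add: mem_sigma) blast
    qed
    ultimately have "(a, b) \<in> Theta_OS G \<longleftrightarrow> (\<forall>i. (phi i a, phi i b) \<in> Theta_OS G)" for a b
      using phi_iff by meson
    then show "theta_congruence phi (Theta_OS G)"
      unfolding theta_congruence_def by (intro conjI lattice_congruence_Theta_OS allI)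
  qed
qed

end

theorem theorem3p1:
  fixes phi phibar :: "'i::linorder \<Rightarrow> 'a::{distrib_lattice, bounded_lattice} \<Rightarrow> 'a"
  assumes "lm_algebra phi phibar"
  shows "lattice_iso (inclusion_order (O_CS phi))
           (inclusion_order {R. lm_congruence phi phibar R}) Theta_OS \<and>
         lattice_iso (inclusion_order (O_Ctheta phi))
           (inclusion_order {R. theta_congruence phi R}) Theta_OS"
proof -
  interpret lm_algebra phi phibar
    by (rule assms)
  show ?thesis
  \<comment> \<open>Beside closure under intersection, the premises left are the two equivalences
    for \<open>Theta_OS G\<close> and the inclusions of the restricted classes in all open sets and
    all lattice congruences.\<close>
  proof (intro conjI lattice_iso_Theta_OS)
    show "\<Inter>\<R> \<in> {R. lm_congruence phi phibar R}" if "\<R> \<subseteq> {R. lm_congruence phi phibar R}" for \<R>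
      using that lm_congruence_Inter by blast
    show "\<Inter>\<R> \<in> {R. theta_congruence phi R}" if "\<R> \<subseteq> {R. theta_congruence phi R}" for \<R>
      using that theta_congruence_Inter by blast
  qed (simp_all add: O_CS_def O_Ctheta_def lm_congruence_Theta_OS_iff theta_congruence_Theta_OS_iff
      Collect_mono_iff lm_congruence_lattice_congruence theta_congruence_lattice_congruence)
qed

end
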